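(* Let $p\ge 5$ be a prime. If $a\in\mathbb{Z}_p^*$ and $b\in\mathbb{Z}_p$, then $\operatorname{rb}(\mathbb{Z}_p,\operatorname{eq}(a,a,a,b))=4$.
   Context: $\mathbb{Z}_n$ denotes the integers modulo $n$, $\mathbb{Z}_n^{*}$ its group of units, and $[r]=\{1,\dots,r\}$. An exact $r$-coloring of $\mathbb{Z}_n$ is a surjective function $c:\mathbb{Z}_n\to[r]$. $\operatorname{eq}(a_1,a_2,a_3,b)$ denotes the equation $a_1x_1+a_2x_2+a_3x_3=b$; a solution in $\mathbb{Z}_n$ is an ordered triple $(s_1,s_2,s_3)$ of elements of $\mathbb{Z}_n$ with $a_1s_1+a_2s_2+a_3s_3\equiv b \pmod n$. A solution is rainbow (with respect to $c$) if $|\{c(s_1),c(s_2),c(s_3)\}|=3$. The rainbow number $\operatorname{rb}(\mathbb{Z}_n,eq)$ is the smallest positive integer $r$ such that every exact $r$-coloring of $\mathbb{Z}_n$ has a rainbow solution to $eq$; by convention it equals $n+1$ if an exact $n$-coloring of $\mathbb{Z}_n$ contains no rainbow solution. *)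

theory Defs
  imports "HOL-Number_Theory.Residues"
begin

text \<open>The ring \<open>\<int>\<^sub>n\<close> is \<^term>\<open>residue_ring (int n)\<close>, whose carrier is
  \<open>{0..int n - 1}\<close>. Colorings are total functions on \<^typ>\<open>int\<close>; only their values
  on this carrier are ever constrained or used.\<close>

definition exact_coloring :: "nat \<Rightarrow> nat \<Rightarrow> (int \<Rightarrow> nat) \<Rightarrow> bool" where
  "exact_coloring n r c \<longleftrightarrow> c ` carrier (residue_ring (int n)) = {1..r}"

definition eq_solutions :: "nat \<Rightarrow> int \<Rightarrow> int \<Rightarrow> int \<Rightarrow> int \<Rightarrow> (int \<times> int \<times> int) set" where
  "eq_solutions n a1 a2 a3 b =
     {(s1, s2, s3). s1 \<in> carrier (residue_ring (int n)) \<and>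
        s2 \<in> carrier (residue_ring (int n)) \<and> s3 \<in> carrier (residue_ring (int n)) \<and>
        [a1 * s1 + a2 * s2 + a3 * s3 = b] (mod (int n))}"

definition has_rainbow_solution ::
    "nat \<Rightarrow> int \<Rightarrow> int \<Rightarrow> int \<Rightarrow> int \<Rightarrow> (int \<Rightarrow> nat) \<Rightarrow> bool" where
  "has_rainbow_solution n a1 a2 a3 b c \<longleftrightarrow>
     (\<exists>(s1, s2, s3) \<in> eq_solutions n a1 a2 a3 b. card {c s1, c s2, c s3} = 3)"

text \<open>The first branch is the convention for the case that an exact \<open>n\<close>-coloring
  has no rainbow solution. In the second branch \<open>r = n\<close> satisfies the condition (for \<open>n > 0\<close>),
  so the minimum is attained.\<close>

definition rainbow_number :: "nat \<Rightarrow> int \<Rightarrow> int \<Rightarrow> int \<Rightarrow> int \<Rightarrow> nat" where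
  "rainbow_number n a1 a2 a3 b =
     (if \<exists>c. exact_coloring n n c \<and> \<not> has_rainbow_solution n a1 a2 a3 b c then n + 1
      else (LEAST r. 0 < r \<and>
        (\<forall>c. exact_coloring n r c \<longrightarrow> has_rainbow_solution n a1 a2 a3 b c)))"

end

theory Submission imports Defs begin

text \<open>
  Suppose that four colors occur on \<open>\<int>\<^sub>p\<close> and that \<open>a x + a y + a z = b\<close> has no rainbow solution.
  Dividing by \<open>a\<close>, the equation reads \<open>x + y + z = d\<close>. If \<open>x + y = z + w\<close> with four different
  colors, then \<open>s = d - x - y\<close> completes both \<open>{x, y}\<close> and \<open>{z, w}\<close> to a solution, and the color
  of \<open>s\<close> can repeat a color of only one of these pairs, so the other solution is rainbow. It thus
  suffices to show that every coloring of \<open>\<int>\<^sub>p\<close> with four colors has a rainbow solution of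
  \<open>x + y = z + w\<close> (lemma \<open>rainbow_sidon\<close>).

  If it had none, fix \<open>t \<noteq> 0\<close> and join two colors when some step from \<open>x\<close> to \<open>x + t\<close> leads from
  one to the other. This graph on the four colors is connected, since steps by \<open>t\<close> run through
  all of \<open>\<int>\<^sub>p\<close>, and it has no perfect matching, since that would be a rainbow solution. A connected
  graph on four vertices without a perfect matching is a star; let \<open>\<phi> t\<close> be its center
  (lemma \<open>step_center_exists\<close>). Color the edge between \<open>x\<close> and \<open>y\<close> of the complete graph on
  \<open>\<int>\<^sub>p\<close> by \<open>\<phi> (x - y)\<close>. Two facts hold.

  First, no triangle is rainbow. If \<open>\<phi> s\<close>, \<open>\<phi> t\<close> and \<open>\<phi> (s + t)\<close> were different, an element of the
  fourth color could not change its color under the step by \<open>s + t\<close>: on the way via \<open>x + s\<close> it could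
  only reach the colors \<open>\<phi> s\<close> and \<open>\<phi> t\<close>, directly only the color \<open>\<phi> (s + t)\<close>. The fourth color would
  then fill \<open>\<int>\<^sub>p\<close>. Second, at least three colors occur as values of \<open>\<phi>\<close>: if \<open>x\<close> and \<open>y\<close>
  have different colors, \<open>\<phi> (y - x)\<close> is one of the two.

  By Gallai's theorem (lemma \<open>gallai\<close>), an edge coloring without rainbow triangles cannot have
  three colors each of which connects all vertices. But each value \<open>\<phi> t\<close> does connect
  \<open>\<int>\<^sub>p\<close>, because the steps by \<open>t\<close> alone do. This contradiction gives a rainbow solution for four
  colors, and for more colors by merging some of them.

  For the lower bound, let \<open>m\<close> be the element with \<open>3 m = d\<close>, color \<open>m\<close> by 1, \<open>m + 1\<close> and \<open>m - 1\<close>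
  by 2 and everything else by 3. A rainbow solution would contain \<open>m\<close>, but then its other two
  members are mirror images of each other about \<open>m\<close> and have the same color.
\<close>

section \<open>Gallai colorings\<close>

text \<open>Disconnectedness of the color \<open>k\<close> on \<open>V\<close>, stated by a cut that no edge of color
  \<open>k\<close> crosses.\<close>

definition avoiding_cut :: "('a \<Rightarrow> 'a \<Rightarrow> 'b) \<Rightarrow> 'b \<Rightarrow> 'a set \<Rightarrow> bool" where
  "avoiding_cut e k V \<longleftrightarrow>
     (\<exists>U. U \<subseteq> V \<and> U \<noteq> {} \<and> U \<noteq> V \<and> (\<forall>u\<in>U. \<forall>w\<in>V - U. e u w \<noteq> k))"

definition component :: "('a \<Rightarrow> 'a \<Rightarrow> 'b) \<Rightarrow> 'b \<Rightarrow> 'a set \<Rightarrow> 'a \<Rightarrow> 'a set" where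
  "component e k W x = {y. (x, y) \<in> {(u, w). u \<in> W \<and> w \<in> W \<and> u \<noteq> w \<and> e u w = k}\<^sup>*}"

lemma component_self: "x \<in> component e k W x"
  by (simp add: component_def)

lemma component_subset: "x \<in> W \<Longrightarrow> component e k W x \<subseteq> W"
proof
  fix y assume "x \<in> W" "y \<in> component e k W x"
  then have "(x, y) \<in> {(u, w). u \<in> W \<and> w \<in> W \<and> u \<noteq> w \<and> e u w = k}\<^sup>*"
    by (simp add: component_def)
  then show "y \<in> W" using \<open>x \<in> W\<close> by induction auto
qed

lemma component_sym:
  assumes "\<And>x y. e x y = e y x" and "y \<in> component e k W x"
  shows "x \<in> component e k W y"
proof -
  have "sym {(u, w). u \<in> W \<and> w \<in> W \<and> u \<noteq> w \<and> e u w = k}"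
    using assms(1) by (auto simp: sym_def)
  then show ?thesis
    using assms(2) sym_rtrancl unfolding component_def sym_def by blast
qed

lemma component_trans:
  "y \<in> component e k W x \<Longrightarrow> z \<in> component e k W y \<Longrightarrow> z \<in> component e k W x"
  by (auto simp: component_def)

lemma component_boundary:
  assumes "x \<in> W" "u \<in> component e k W x" "z \<in> W - component e k W x"
  shows "e u z \<noteq> k"
proof
  assume "e u z = k"
  moreover have "u \<in> W" "u \<noteq> z" using assms component_subset[of x W e k] by auto
  ultimately have "z \<in> component e k W u"
    using assms(3) by (auto simp: component_def)
  then show False using assms component_trans by fastforce
qed

text \<open>The key to Gallai's theorem: an outside vertex sees a whole component in a single color.
  For adjacent \<open>u\<close> and \<open>w\<close> in the component, the triangle with \<open>z\<close> has one edge of color \<open>k\<close> and two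
  edges of other colors, which must therefore agree.\<close>

lemma component_twins:
  assumes sym: "\<And>x y. e x y = e y x"
    and tri: "\<And>x y z. \<lbrakk>x \<in> W; y \<in> W; z \<in> W; x \<noteq> y; y \<noteq> z; x \<noteq> z\<rbrakk>
                \<Longrightarrow> e x y = e y z \<or> e y z = e x z \<or> e x y = e x z"
    and x: "x \<in> W" and u: "u \<in> component e k W x" and z: "z \<in> W - component e k W x"
  shows "e u z = e x z"
proof -
  have "(x, u) \<in> {(u, w). u \<in> W \<and> w \<in> W \<and> u \<noteq> w \<and> e u w = k}\<^sup>*"
    using u by (simp add: component_def)
  then show ?thesis
  proof induction
    case base
    show ?case ..
  next
    case (step y w)
    have yw: "y \<in> component e k W x" "w \<in> component e k W x"
      using step.hyps(1) rtrancl_into_rtrancl[OF step.hyps] unfolding component_def by simp_all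
    have "e y z \<noteq> k" "e w z \<noteq> k"
      by (rule component_boundary[OF x yw(1) z], rule component_boundary[OF x yw(2) z])
    moreover have "y \<noteq> z" "w \<noteq> z" using yw z by auto
    ultimately show ?case using step z tri[of y w z] by auto
  qed
qed

text \<open>Add a vertex \<open>v\<close> to \<open>W\<close>, where by induction some color \<open>k\<close> is disconnected. If all three
  colors became connected, \<open>v\<close> would send an edge of color \<open>k\<close> to every \<open>k\<close>-component of \<open>W\<close>, and
  edges of the other two colors \<open>i\<close> and \<open>j\<close> to some \<open>w\<close> and \<open>w'\<close>. An edge of color \<open>l \<noteq> k\<close> from \<open>v\<close>
  to \<open>w\<close> forces all edges from \<open>w\<close> to other components to have color \<open>l\<close>; applied to \<open>i\<close> and to \<open>j\<close>,
  this is contradictory.\<close>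

lemma gallai:
  assumes "finite V" and "2 \<le> card V" and sym: "\<And>x y. e x y = e y x"
    and "\<And>x y z. \<lbrakk>x \<in> V; y \<in> V; z \<in> V; x \<noteq> y; y \<noteq> z; x \<noteq> z\<rbrakk>
                \<Longrightarrow> e x y = e y z \<or> e y z = e x z \<or> e x y = e x z"
    and K: "card K = 3"
  shows "\<exists>k\<in>K. avoiding_cut e k V"
  using assms(1,2,4)
proof (induction V rule: finite_induct)
  case empty
  then show ?case by simp
next
  case (insert v W)
  note tri = insert.prems(2)
  show ?case
  proof (cases "2 \<le> card W")
    case False
    then have "card W = 1" using insert by auto
    then obtain w where w: "W = {w}" by (auto simp: card_1_singleton_iff)
    have "\<not> K \<subseteq> {e v w}" using K card_mono[of "{e v w}" K] by auto
    then obtain k where "k \<in> K" "k \<noteq> e v w" by blast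
    then show ?thesis
      using w insert.hyps unfolding avoiding_cut_def
      by (intro bexI[of _ k] exI[of _ "{v}"]) auto
  next
    case True
    have triW: "\<And>x y z. \<lbrakk>x \<in> W; y \<in> W; z \<in> W; x \<noteq> y; y \<noteq> z; x \<noteq> z\<rbrakk>
                \<Longrightarrow> e x y = e y z \<or> e y z = e x z \<or> e x y = e x z"
      using tri by blast
    obtain k where k: "k \<in> K" "avoiding_cut e k W"
      using insert.IH[OF True triW] by blast
    show ?thesis
    proof (rule ccontr)
      assume no_cut: "\<not> ?thesis"
      let ?C = "component e k W"
      have "card (K - {k}) = 2" using K k by (simp add: card_Diff_singleton)
      then obtain i j where ij: "i \<in> K" "j \<in> K" "i \<noteq> k" "j \<noteq> k" "i \<noteq> j"
        by (auto simp: card_2_iff doubleton_eq_iff)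
      have proper: "\<exists>z. z \<in> W - ?C x" if "x \<in> W" for x
      proof -
        obtain U where U: "U \<subseteq> W" "U \<noteq> {}" "U \<noteq> W" "\<And>u w. u \<in> U \<Longrightarrow> w \<in> W - U \<Longrightarrow> e u w \<noteq> k"
          using k(2) unfolding avoiding_cut_def by blast
        have "y \<in> U \<longleftrightarrow> x \<in> U" if "y \<in> ?C x" for y
        proof -
          have "(x, y) \<in> {(u, w). u \<in> W \<and> w \<in> W \<and> u \<noteq> w \<and> e u w = k}\<^sup>*"
            using that by (simp add: component_def)
          then show ?thesis
          proof induction
            case base
            show ?case ..
          next
            case (step a b)
            then show ?case using U(4)[of a b] U(4)[of b a] sym[of a b] by auto
          qed
        qed
        then show ?thesis using U(1-3) \<open>x \<in> W\<close> by blast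
      qed
      have reach: "\<exists>u\<in>?C x. e v u = k" if "x \<in> W" for x
      proof -
        have "?C x \<subseteq> insert v W" "?C x \<noteq> {}" "?C x \<noteq> insert v W"
          using component_subset[OF that, of e k] component_self[of x e k W] insert.hyps by auto
        then obtain u w where uw: "u \<in> ?C x" "w \<in> insert v W - ?C x" "e u w = k"
          using no_cut k(1) unfolding avoiding_cut_def by blast
        then have "w = v" using component_boundary[OF that uw(1), of w] by blast
        then show ?thesis using uw sym[of u v] by auto
      qed
      have twins: "e u z = e x z" if "x \<in> W" "u \<in> ?C x" "z \<in> W - ?C x" for x u z
        using sym triW that by (rule component_twins[where e = e and W = W and k = k])
      have star: "\<exists>w\<in>W. e v w = l" if "l \<in> K" for l
      proof (rule ccontr)
        assume "\<not> ?thesis"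
        moreover have "W \<noteq> {}" using True by auto
        ultimately have "avoiding_cut e l (insert v W)"
          using insert.hyps unfolding avoiding_cut_def
          by (intro exI[of _ "{v}"]) auto
        then show False using no_cut that by blast
      qed
      \<comment> \<open>Go around the triangle of \<open>v\<close>, \<open>w\<close> and a vertex \<open>u\<close> in the component of \<open>z\<close> for which
        the edge from \<open>v\<close> has color \<open>k\<close>.\<close>
      have spread: "e w z = l" if "w \<in> W" "e v w = l" "l \<noteq> k" "z \<in> W - ?C w" for l w z
      proof -
        have "z \<in> W" using that by blast
        then obtain u where u: "u \<in> ?C z" "e v u = k" using reach by blast
        have uW: "u \<in> W" using u(1) component_subset[of z W e k] that by blast
        have "w \<notin> ?C z"
        proof
          assume "w \<in> ?C z"
          then have "z \<in> ?C w" by (rule component_sym[OF sym])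
          then show False using that(4) by blast
        qed
        then have wz: "w \<in> W - ?C z" using that(1) by blast
        have "e u w \<noteq> k" using component_boundary[OF \<open>z \<in> W\<close> u(1) wz] .
        moreover have "u \<noteq> w" using u(2) that(2,3) by auto
        ultimately have "e u w = l"
          using tri[of v u w] u(2) that uW insert.hyps by auto
        moreover have "e u w = e z w"
          using twins[OF \<open>z \<in> W\<close> u(1) wz] .
        ultimately show ?thesis using sym by metis
      qed
      obtain w where w: "w \<in> W" "e v w = i" using star ij by blast
      obtain w' where w': "w' \<in> W" "e v w' = j" using star ij by blast
      show False
      \<comment> \<open>In the same component, \<open>w\<close> and \<open>w'\<close> see any outside vertex in the same color, yet also
        in the colors \<open>i\<close> and \<open>j\<close>. In different components, the edge between them has both colors.\<close>
      proof (cases "w' \<in> ?C w")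
        case True
        obtain z where z: "z \<in> W - ?C w" using proper w by blast
        have "z \<in> W - ?C w'" using z True component_trans by fastforce
        then have "e w' z = j" using spread w' ij by blast
        moreover have "e w z = i" using spread w z ij by blast
        moreover have "e w' z = e w z"
          using twins[OF w(1) True z] .
        ultimately show False using ij by simp
      next
        case False
        then have "w \<notin> ?C w'" using component_sym[where e = e, OF sym] by fast
        then have "e w w' = i" "e w' w = j" using spread w w' False ij by blast+
        then show False using sym[of w w'] ij by simp
      qed
    qed
  qed
qed

section \<open>Steps of the cyclic group of prime order\<close>

text \<open>A nonzero element generates \<open>\<int>\<^sub>p\<close>, so no proper nonempty subset is closed under adding it.
  Subsets of \<open>\<int>\<^sub>p\<close> are given by periodic predicates on the integers, which allows addition
  without reduction.\<close>

lemma periodic_closed_under_step: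
  fixes p :: nat and t :: int
  assumes p: "prime p" and t: "\<not> int p dvd t"
    and periodic: "\<And>x y. [x = y] (mod int p) \<Longrightarrow> P x \<Longrightarrow> P y"
    and step: "\<And>x. P x \<Longrightarrow> P (x + t)" and x: "P x"
  shows "P y"
proof -
  have iter: "P (x + int n * t)" for n
  proof (induction n)
    case (Suc n)
    then show ?case using step[of "x + int n * t"] by (simp add: algebra_simps)
  qed (simp add: x)
  have "coprime t (int p)"
    using p t by (metis coprime_commute prime_imp_coprime prime_int_nat_transfer nat_int of_nat_0_le_iff)
  then obtain s where "[t * s = 1] (mod int p)" using cong_solve_coprime_int by blast
  then have s: "[t * s * (y - x) = 1 * (y - x)] (mod int p)" by (rule cong_scalar_right)
  define n where "n = nat ((s * (y - x)) mod int p)"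
  have "int n = (s * (y - x)) mod int p"
    using p by (simp add: n_def prime_gt_0_nat)
  then have "[int n * t = s * (y - x) * t] (mod int p)"
    by (intro cong_scalar_right) (simp add: cong_def)
  moreover have "s * (y - x) * t = t * s * (y - x)" by (simp only: ac_simps)
  ultimately have "[int n * t = t * s * (y - x)] (mod int p)" by simp
  then have "[int n * t = y - x] (mod int p)"
    using cong_trans[OF _ s] by simp
  then have "[x + int n * t = y] (mod int p)"
    using cong_add_lcancel[of x "int n * t" "y - x" "int p"] by simp
  then show ?thesis using periodic iter by blast
qed

section \<open>Rainbow solutions of x + y = z + w\<close>

text \<open>Every change of color along a step by \<open>t\<close> enters or leaves the color \<open>k\<close>, so the graph of
  color changes is a star around \<open>k\<close>.\<close>

definition step_center :: "(int \<Rightarrow> 'b) \<Rightarrow> int \<Rightarrow> 'b \<Rightarrow> bool" where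
  "step_center f t k \<longleftrightarrow> (\<forall>x. f x \<noteq> f (x + t) \<longrightarrow> f x = k \<or> f (x + t) = k)"

lemma step_center_uminus: "step_center f (- t) = step_center f t"
proof -
  have "step_center f (- t) k" if "step_center f t k" for t k
    unfolding step_center_def
  proof (intro allI impI)
    fix x assume "f x \<noteq> f (x + - t)"
    then show "f x = k \<or> f (x + - t) = k"
      using that[unfolded step_center_def, rule_format, of "x - t"] by auto
  qed
  from this[of t] this[of "- t"] show ?thesis by (auto simp: fun_eq_iff)
qed

lemma step_center_cong:
  fixes p :: int
  assumes f: "\<And>x y. [x = y] (mod p) \<Longrightarrow> f x = f y" and "[s = t] (mod p)"
  shows "step_center f s = step_center f t"
proof -
  have "f (x + s) = f (x + t)" for x
    using assms by (simp add: cong_add_lcancel)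
  then show ?thesis by (simp add: step_center_def fun_eq_iff)
qed

text \<open>Color changes along \<open>t\<close> form a connected graph \<open>E\<close> on four vertices. Two disjoint edges
  \<open>f x\<close>, \<open>f (x + t)\<close> and \<open>f y\<close>, \<open>f (y + t)\<close> would be a rainbow solution
  \<open>x + (y + t) = (x + t) + y\<close>. Without a perfect matching, connectedness leaves only stars.\<close>

lemma step_center_exists:
  fixes p :: nat and f :: "int \<Rightarrow> nat"
  assumes p: "prime p" and f: "\<And>x y. [x = y] (mod int p) \<Longrightarrow> f x = f y"
    and range: "range f = {1..4}"
    and sidon_free: "\<And>x y t. \<not> distinct [f x, f (x + t), f y, f (y + t)]"
    and t: "\<not> int p dvd t"
  shows "\<exists>k\<in>{1..4}. step_center f t k"
proof -
  define E where "E i j \<longleftrightarrow> (\<exists>x. f x = i \<and> f (x + t) = j \<or> f x = j \<and> f (x + t) = i)" for i j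
  have no_matching: "\<not> (E i j \<and> E k l)" if "distinct [i, j, k, l]" for i j k l
  proof
    assume "E i j \<and> E k l"
    then obtain x y where
        "f x = i \<and> f (x + t) = j \<or> f x = j \<and> f (x + t) = i"
        "f y = k \<and> f (y + t) = l \<or> f y = l \<and> f (y + t) = k"
      unfolding E_def by blast
    then show False using sidon_free[of x t y] that by auto
  qed
  have four: "{1..4::nat} = {1, 2, 3, 4}" by auto
  have leave: "\<exists>i\<in>S. \<exists>j\<in>{1, 2, 3, 4} - S. E i j"
    if ab: "a \<in> S" "b \<notin> S" "a \<in> {1, 2, 3, 4}" "b \<in> {1, 2, 3, 4}" for S a b
  proof (rule ccontr)
    assume "\<not> ?thesis"
    then have closed: "f (x + t) \<in> S" if "f x \<in> S" for x
      using that rangeI[of f "x + t"] unfolding E_def range four by blast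
    have "a \<in> range f" "b \<in> range f" using ab(3,4) unfolding range four .
    then obtain x y where x: "f x \<in> S" and y: "f y \<notin> S" using ab(1,2) by auto
    have "f y \<in> S" for y
    proof (rule periodic_closed_under_step[OF p t, where P = "\<lambda>x. f x \<in> S" and x = x])
      show "\<And>x y. [x = y] (mod int p) \<Longrightarrow> f x \<in> S \<Longrightarrow> f y \<in> S" using f by metis
    qed (use closed x in auto)
    then show False using y by blast
  qed
  have E_sym: "E i j \<longleftrightarrow> E j i" for i j by (auto simp: E_def)
  \<comment> \<open>The seven cuts of a set of four elements and its three perfect matchings.\<close>
  have "E 1 2 \<or> E 1 3 \<or> E 1 4" using leave[of 1 "{1}" 2] by auto
  moreover have "E 1 2 \<or> E 2 3 \<or> E 2 4" using leave[of 2 "{2}" 1] E_sym[of 2 1] by auto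
  moreover have "E 1 3 \<or> E 2 3 \<or> E 3 4"
    using leave[of 3 "{3}" 1] E_sym[of 3 1] E_sym[of 3 2] by auto
  moreover have "E 1 4 \<or> E 2 4 \<or> E 3 4"
    using leave[of 4 "{4}" 1] E_sym[of 4 1] E_sym[of 4 2] E_sym[of 4 3] by auto
  moreover have "E 1 3 \<or> E 1 4 \<or> E 2 3 \<or> E 2 4" using leave[of 1 "{1, 2}" 3] by auto
  moreover have "E 1 2 \<or> E 1 4 \<or> E 2 3 \<or> E 3 4"
    using leave[of 1 "{1, 3}" 2] E_sym[of 3 2] by auto
  moreover have "E 1 2 \<or> E 1 3 \<or> E 2 4 \<or> E 3 4"
    using leave[of 1 "{1, 4}" 2] E_sym[of 4 2] E_sym[of 4 3] by auto
  moreover have "\<not> (E 1 2 \<and> E 3 4)" "\<not> (E 1 3 \<and> E 2 4)" "\<not> (E 1 4 \<and> E 2 3)"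
    by (rule no_matching; simp)+
  ultimately consider
      "\<not> E 2 3 \<and> \<not> E 2 4 \<and> \<not> E 3 4" | "\<not> E 1 3 \<and> \<not> E 1 4 \<and> \<not> E 3 4"
    | "\<not> E 1 2 \<and> \<not> E 1 4 \<and> \<not> E 2 4" | "\<not> E 1 2 \<and> \<not> E 1 3 \<and> \<not> E 2 3"
    by argo
  then obtain k where k: "k \<in> {1..4}"
      "\<And>i j. i \<in> {1..4} \<Longrightarrow> j \<in> {1..4} \<Longrightarrow> i \<noteq> j \<Longrightarrow> i \<noteq> k \<Longrightarrow> j \<noteq> k \<Longrightarrow> \<not> E i j"
  proof cases
    case 1 then show ?thesis using that[of 1] E_sym unfolding four by blast
  next
    case 2 then show ?thesis using that[of 2] E_sym unfolding four by blast
  next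
    case 3 then show ?thesis using that[of 3] E_sym unfolding four by blast
  next
    case 4 then show ?thesis using that[of 4] E_sym unfolding four by blast
  qed
  have "step_center f t k"
    unfolding step_center_def using k(2) range unfolding E_def by blast
  then show ?thesis using k(1) by blast
qed

text \<open>The solution \<open>x + (y + t) = (x + t) + y\<close> is parametrized by the common difference \<open>t\<close>. If
  there is no rainbow one, the centers of the color changes form a Gallai coloring in which at
  least three colors occur, each of them connecting all vertices.\<close>

theorem rainbow_sidon:
  fixes p :: nat and f :: "int \<Rightarrow> nat"
  assumes p: "prime p" and f: "\<And>x y. [x = y] (mod int p) \<Longrightarrow> f x = f y"
    and range: "range f = {1..4}"
  shows "\<exists>x y t. distinct [f x, f (x + t), f y, f (y + t)]"
proof (rule ccontr)
  assume "\<not> ?thesis"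
  then have sidon_free: "\<And>x y t. \<not> distinct [f x, f (x + t), f y, f (y + t)]" by blast
  define \<phi> where "\<phi> t = (SOME k. k \<in> {1..4} \<and> step_center f t k)" for t
  have \<phi>: "\<phi> t \<in> {1..4}" "step_center f t (\<phi> t)" if "\<not> int p dvd t" for t
  proof -
    have "\<exists>k. k \<in> {1..4} \<and> step_center f t k"
      using step_center_exists[where f = f and t = t, OF p f range sidon_free that]
      by (simp only: Bex_def)
    from someI_ex[OF this] show "\<phi> t \<in> {1..4}" "step_center f t (\<phi> t)"
      unfolding \<phi>_def by simp_all
  qed
  have \<phi>_uminus: "\<phi> (- t) = \<phi> t" for t
    by (simp add: \<phi>_def step_center_uminus)
  have \<phi>_cong: "\<phi> s = \<phi> t" if "[s = t] (mod int p)" for s t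
    using step_center_cong[OF f that] by (simp add: \<phi>_def)
  have \<phi>_gallai: "\<phi> s = \<phi> t \<or> \<phi> t = \<phi> (s + t) \<or> \<phi> s = \<phi> (s + t)"
    if st: "\<not> int p dvd s" "\<not> int p dvd t" "\<not> int p dvd s + t" for s t
  proof (rule ccontr)
    assume neq: "\<not> ?thesis"
    let ?T = "{\<phi> s, \<phi> t, \<phi> (s + t)}"
    have "card ?T = 3" using neq by auto
    then have "{1..4} - ?T \<noteq> {}"
      using card_mono[of ?T "{1..4}"] by auto
    then obtain d where d: "d \<in> {1..4}" "d \<noteq> \<phi> s" "d \<noteq> \<phi> t" "d \<noteq> \<phi> (s + t)" by blast
    \<comment> \<open>Via \<open>x + s\<close> the color \<open>d\<close> can turn only into \<open>\<phi> s\<close> or \<open>\<phi> t\<close>, in one step only into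
      \<open>\<phi> (s + t)\<close>.\<close>
    have closed: "f (x + (s + t)) = d" if "f x = d" for x
    proof -
      have "f (x + s) = d \<or> f (x + s) = \<phi> s"
        using \<phi>(2)[OF st(1)] that d unfolding step_center_def by metis
      moreover have "f (x + s) = f (x + s + t) \<or> f (x + s) = \<phi> t \<or> f (x + s + t) = \<phi> t"
        using \<phi>(2)[OF st(2)] unfolding step_center_def by metis
      moreover have "f (x + (s + t)) = d \<or> f (x + (s + t)) = \<phi> (s + t)"
        using \<phi>(2)[OF st(3)] that d unfolding step_center_def by metis
      ultimately show ?thesis using neq d by (auto simp: add.assoc)
    qed
    obtain x where x: "f x = d" using d(1) unfolding range[symmetric] by auto
    have "f y = d" for y
    proof (rule periodic_closed_under_step[OF p st(3), where P = "\<lambda>x. f x = d" and x = x])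
      show "\<And>x y. [x = y] (mod int p) \<Longrightarrow> f x = d \<Longrightarrow> f y = d" using f by metis
    qed (use closed x in auto)
    then have "range f = {d}" by auto
    then have "card (range f) = 1" by simp
    then show False using range by simp
  qed
  let ?V = "{0..<int p}"
  let ?e = "\<lambda>x y. \<phi> (x - y)"
  have ndvd: "\<not> int p dvd x - y" if "x \<in> ?V" "y \<in> ?V" "x \<noteq> y" for x y
    using that by (metis atLeastLessThan_iff cong_iff_dvd_diff cong_less_imp_eq_int)
  define Q where "Q = {k \<in> {1..4}. \<exists>t. \<not> int p dvd t \<and> \<phi> t = k}"
  have pair: "i \<in> Q \<or> j \<in> Q" if ij: "i \<in> {1..4}" "j \<in> {1..4}" "i \<noteq> j" for i j
  proof -
    obtain x y where xy: "f x = i" "f y = j"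
      using ij(1,2) unfolding range[symmetric] by auto
    then have "\<not> int p dvd y - x" using f[of y x] \<open>i \<noteq> j\<close> cong_iff_dvd_diff by metis
    moreover from \<phi>(2)[OF this] have "\<phi> (y - x) = i \<or> \<phi> (y - x) = j"
      using xy that(3) unfolding step_center_def by (metis add_diff_cancel_left' add.commute diff_add_cancel)
    ultimately show ?thesis using that unfolding Q_def by blast
  qed
  \<comment> \<open>Among any two colors one is a center, so at most one of the four is not.\<close>
  have "3 \<le> card Q"
  proof -
    have "card ({1..4} - Q) \<le> Suc 0"
      using pair by (subst card_le_Suc0_iff_eq) (simp, blast)
    moreover have "Q \<subseteq> {1..4}" by (auto simp: Q_def)
    ultimately show ?thesis using card_Diff_subset[of Q "{1..4}"] finite_subset[of Q "{1..4}"] by simp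
  qed
  then obtain K where K: "K \<subseteq> Q" "card K = 3" by (meson obtain_subset_with_card_n)
  have "\<exists>k\<in>K. avoiding_cut ?e k ?V"
  proof (rule gallai)
    show "2 \<le> card ?V" using p by (simp add: prime_ge_2_nat)
    show "\<phi> (x - y) = \<phi> (y - x)" for x y using \<phi>_uminus[of "x - y"] by simp
    show "\<phi> (x - y) = \<phi> (y - z) \<or> \<phi> (y - z) = \<phi> (x - z) \<or> \<phi> (x - y) = \<phi> (x - z)"
      if "x \<in> ?V" "y \<in> ?V" "z \<in> ?V" "x \<noteq> y" "y \<noteq> z" "x \<noteq> z" for x y z
      using \<phi>_gallai[of "x - y" "y - z"] ndvd that by simp
  qed (use K in auto)
  then obtain k U where k: "k \<in> K" and U: "U \<subseteq> ?V" "U \<noteq> {}" "U \<noteq> ?V"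
      "\<And>u w. u \<in> U \<Longrightarrow> w \<in> ?V - U \<Longrightarrow> \<phi> (u - w) \<noteq> k"
    unfolding avoiding_cut_def by blast
  obtain t where t: "\<not> int p dvd t" "\<phi> t = k" using k K by (auto simp: Q_def)
  obtain u where u: "u \<in> U" using U by blast
  \<comment> \<open>A step by \<open>t\<close> is an edge of color \<open>k\<close>, so it cannot leave the side \<open>U\<close> of the cut.\<close>
  have "y mod int p \<in> U" for y
  proof (rule periodic_closed_under_step[OF p t(1), where P = "\<lambda>x. x mod int p \<in> U" and x = u])
    show "u mod int p \<in> U" using u U(1) by (metis atLeastLessThan_iff mod_pos_pos_trivial subsetD)
    show "(x + t) mod int p \<in> U" if "x mod int p \<in> U" for x
    proof (rule ccontr)
      assume "(x + t) mod int p \<notin> U"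
      then have "(x + t) mod int p \<in> ?V - U" using p by (simp add: prime_gt_0_nat)
      then have "\<phi> (x mod int p - (x + t) mod int p) \<noteq> k" using U(4) that by blast
      moreover have "[x mod int p - (x + t) mod int p = - t] (mod int p)"
        by (simp add: cong_def mod_diff_eq)
      ultimately show False using \<phi>_cong \<phi>_uminus t(2) by metis
    qed
  qed (simp add: cong_def)
  then have "?V \<subseteq> U" by (metis atLeastLessThan_iff mod_pos_pos_trivial subsetI)
  then show False using U by blast
qed

section \<open>Merging colors\<close>

lemma carrier_residue_ring: "carrier (residue_ring m) = {0..m - 1}"
  by (simp add: residue_ring_def)

text \<open>Replacing \<open>c\<close> by \<open>min r c\<close> identifies all colors from \<open>r\<close> on. This cannot create rainbow
  solutions, which carries the upper bound to more than four colors and the lower bound to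
  fewer than three.\<close>

lemma exact_coloring_merge:
  assumes "exact_coloring n s c" "1 \<le> r" "r \<le> s"
  shows "exact_coloring n r (\<lambda>x. min r (c x))"
proof -
  have "min r ` {1..s} = {1..r}"
  proof
    show "{1..r} \<subseteq> min r ` {1..s}"
      using assms by (auto intro!: image_eqI[where f = "min r"])
  qed (use assms in auto)
  then show ?thesis
    using assms(1) unfolding exact_coloring_def by (metis image_image)
qed

lemma has_rainbow_solution_merge:
  assumes "has_rainbow_solution n a1 a2 a3 b (\<lambda>x. min r (c x))"
  shows "has_rainbow_solution n a1 a2 a3 b c"
proof -
  have "card {x, y, z} = 3" if "card {min r x, min r y, min r z} = 3" for x y z :: nat
    using that by (auto simp: card_insert_if split: if_splits)
  then show ?thesis
    using assms unfolding has_rainbow_solution_def by blast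
qed

section \<open>The rainbow number\<close>

text \<open>In a solution of \<open>x + (y + t) = (x + t) + y\<close> with four different colors, both sides are
  completed to a solution of the equation by the same element \<open>s\<close>. The color of \<open>s\<close> can repeat a color
  on one side only.\<close>

lemma rainbow_solution_of_four_colors:
  fixes p :: nat and a b :: int
  assumes p: "prime p" and a: "coprime a (int p)" and c: "exact_coloring p 4 c"
  shows "has_rainbow_solution p a a a b c"
proof -
  define f where "f x = c (x mod int p)" for x
  have pos: "0 < int p" using p by (simp add: prime_gt_0_nat)
  have f: "f x = f y" if "[x = y] (mod int p)" for x y
    using that by (simp add: f_def cong_def)
  have "(\<lambda>x. x mod int p) ` UNIV = {0..int p - 1}"
  proof
    show "{0..int p - 1} \<subseteq> range (\<lambda>x. x mod int p)"
    proof
      fix x assume "x \<in> {0..int p - 1}"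
      then have "x = x mod int p" by simp
      then show "x \<in> range (\<lambda>x. x mod int p)" by (rule range_eqI)
    qed
  qed (use pos in auto)
  then have "range f = {1..4}"
    using c unfolding exact_coloring_def carrier_residue_ring f_def by (metis image_image)
  then have "\<exists>x y t. distinct [f x, f (x + t), f y, f (y + t)]"
    using f by (intro rainbow_sidon[where f = f, OF p])
  then obtain x y t where xyt: "distinct [f x, f (x + t), f y, f (y + t)]" by blast
  obtain a' where "[a * a' = 1] (mod int p)" using a cong_solve_coprime_int by blast
  then have a': "[a * a' * b = 1 * b] (mod int p)" by (rule cong_scalar_right)
  define s where "s = a' * b - x - y - t"
  have rainbow: ?thesis if "u + v + s = a' * b" "card {f u, f v, f s} = 3" for u v
  proof -
    have "[a * (u mod int p) + a * (v mod int p) + a * (s mod int p) = a * u + a * v + a * s] (mod int p)"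
      by (intro cong_add cong_scalar_left) simp_all
    also have "a * u + a * v + a * s = a * a' * b" using that(1) by (metis distrib_left mult.assoc)
    also have "[\<dots> = b] (mod int p)" using a' by simp
    finally have "(u mod int p, v mod int p, s mod int p) \<in> eq_solutions p a a a b"
      using pos by (simp add: eq_solutions_def carrier_residue_ring)
    then show ?thesis using that(2) unfolding has_rainbow_solution_def f_def by blast
  qed
  show ?thesis
  proof (cases "f s = f x \<or> f s = f (y + t)")
    case True
    then have "card {f (x + t), f y, f s} = 3" using xyt by auto
    then show ?thesis using rainbow[of "x + t" y] by (simp add: s_def)
  next
    case False
    then have "card {f x, f (y + t), f s} = 3" using xyt by auto
    then show ?thesis using rainbow[of x "y + t"] by (simp add: s_def)
  qed
qed

text \<open>The coloring is symmetric about the solution \<open>m\<close> of \<open>3 a m = b\<close>, which is the only element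
  of color 1. A third color is left because \<open>p \<ge> 5\<close>, and \<open>m\<close> exists because \<open>p \<noteq> 3\<close>.\<close>

lemma rainbow_free_three_coloring:
  fixes p :: nat and a b :: int
  assumes p: "prime p" "5 \<le> p" and a: "coprime a (int p)"
  shows "\<exists>c. exact_coloring p 3 c \<and> \<not> has_rainbow_solution p a a a b c"
proof -
  have "\<not> p dvd 3" using p(2) by (auto dest: dvd_imp_le)
  then have "coprime (int p) (int 3)"
    unfolding coprime_int_iff by (rule prime_imp_coprime[OF p(1)])
  then have "coprime (a * 3) (int p)"
    using a by (simp add: coprime_commute)
  then obtain e where "[a * 3 * e = 1] (mod int p)" using cong_solve_coprime_int by blast
  then have e: "[a * 3 * e * b = 1 * b] (mod int p)" by (rule cong_scalar_right)
  define m where "m = e * b"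
  define g :: "int \<Rightarrow> nat" where
    "g u = (if int p dvd u then 1 else if int p dvd u - 1 \<or> int p dvd u + 1 then 2 else 3)" for u
  define c where "c x = g (x - m)" for x
  have g_range: "g u \<in> {1, 2, 3}" for u by (simp add: g_def)
  have g_uminus: "g (- u) = g u" for u
  proof -
    have "int p dvd - u - 1 \<longleftrightarrow> int p dvd u + 1" "int p dvd - u + 1 \<longleftrightarrow> int p dvd u - 1"
      using dvd_minus_iff[of "int p" "u + 1"] dvd_minus_iff[of "int p" "u - 1"] by simp_all
    then show ?thesis by (auto simp: g_def)
  qed
  have g_cong: "g u = g v" if "int p dvd u - v" for u v
  proof -
    have "int p dvd u + w \<longleftrightarrow> int p dvd v + w" for w
      using dvd_add_right_iff[OF that, of "v + w"] by simp
    from this[of 0] this[of 1] this[of "- 1"] show ?thesis by (simp add: g_def)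
  qed
  have twins: "g v = g w" if "int p dvd u + v + w" "g u = 1" for u v w
  proof -
    have "int p dvd u" using that(2) by (simp add: g_def split: if_splits)
    then have "int p dvd v - - w" using that(1) by (metis add.assoc diff_minus_eq_add dvd_add_right_iff)
    then show ?thesis using g_cong g_uminus by metis
  qed
  have "c ` {0..int p - 1} = {1..3}"
  proof
    show "c ` {0..int p - 1} \<subseteq> {1..3}"
    proof (rule image_subsetI)
      fix x show "c x \<in> {1..3}" using g_range[of "x - m"] unfolding c_def by auto
    qed
    have "g u \<in> c ` {0..int p - 1}" for u
    proof -
      have "int p dvd u - ((u + m) mod int p - m)"
        by (metis cong_iff_dvd_diff cong_def mod_diff_left_eq add_diff_cancel_right')
      then have "g u = c ((u + m) mod int p)" unfolding c_def by (rule g_cong)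
      then show ?thesis using p by auto
    qed
    moreover have "g 0 = 1" "g 1 = 2" "g 2 = 3"
      using p(2) by (auto simp: g_def dest!: zdvd_imp_le)
    moreover have "{1..3::nat} = {1, 2, 3}" by auto
    ultimately show "{1..3} \<subseteq> c ` {0..int p - 1}" by (metis empty_subsetI insert_subset)
  qed
  then have "exact_coloring p 3 c" by (simp add: exact_coloring_def carrier_residue_ring)
  moreover have "\<not> has_rainbow_solution p a a a b c"
  proof
    assume "has_rainbow_solution p a a a b c"
    then obtain x y z where xyz: "[a * x + a * y + a * z = b] (mod int p)"
        and rainbow: "card {c x, c y, c z} = 3"
      unfolding has_rainbow_solution_def eq_solutions_def by blast
    have "[a * (x + y + z) = a * (3 * m)] (mod int p)"
      using cong_trans[OF xyz cong_sym[OF e[simplified]]] by (simp add: m_def algebra_simps)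
    then have "[x + y + z = 3 * m] (mod int p)" using a cong_mult_lcancel by blast
    then have sum: "int p dvd (x - m) + (y - m) + (z - m)"
      by (simp add: cong_iff_dvd_diff algebra_simps)
    have "c x = 1 \<or> c y = 1 \<or> c z = 1"
    proof (rule ccontr)
      assume "\<not> ?thesis"
      then have "{c x, c y, c z} \<subseteq> {2, 3}" using g_range unfolding c_def by blast
      then have "card {c x, c y, c z} \<le> card {2, 3::nat}" by (intro card_mono) auto
      then show False using rainbow by simp
    qed
    then have "c y = c z \<or> c x = c z \<or> c x = c y"
      using twins[of "x - m" "y - m" "z - m"] twins[of "y - m" "x - m" "z - m"]
        twins[of "z - m" "x - m" "y - m"] sum
      unfolding c_def by (auto simp: algebra_simps)
    then show False using rainbow by (auto simp: card_insert_if split: if_splits)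
  qed
  ultimately show ?thesis by blast
qed

theorem theorem2p5:
  fixes p :: nat and a b :: int
  assumes "prime p" and "p \<ge> 5"
    and "a \<in> Units (residue_ring (int p))"
    and "b \<in> carrier (residue_ring (int p))"
  shows "rainbow_number p a a a b = 4"
proof -
  interpret residues_prime p "residue_ring (int p)"
    using assms(1) by unfold_locales auto
  have a: "coprime a (int p)" using assms(3) by (simp add: res_units_eq)
  have many: "has_rainbow_solution p a a a b c" if "exact_coloring p r c" "4 \<le> r" for r c
    using has_rainbow_solution_merge rainbow_solution_of_four_colors[OF assms(1) a]
      exact_coloring_merge[OF that(1) _ that(2)] by (metis one_le_numeral)
  obtain c where c: "exact_coloring p 3 c" "\<not> has_rainbow_solution p a a a b c"
    using rainbow_free_three_coloring[OF assms(1,2) a] by blast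
  have few: "\<exists>c. exact_coloring p r c \<and> \<not> has_rainbow_solution p a a a b c" if "0 < r" "r < 4" for r
  proof -
    have "exact_coloring p r (\<lambda>x. min r (c x))"
      using exact_coloring_merge[OF c(1)] that by simp
    then show ?thesis using has_rainbow_solution_merge c(2) by blast
  qed
  have "(LEAST r. 0 < r \<and> (\<forall>c. exact_coloring p r c \<longrightarrow> has_rainbow_solution p a a a b c)) = 4"
    using many few by (intro Least_equality) (auto simp: not_less[symmetric])
  moreover have "\<not> (\<exists>c. exact_coloring p p c \<and> \<not> has_rainbow_solution p a a a b c)"
    using many assms(2) by auto
  ultimately show ?thesis unfolding rainbow_number_def by (simp only: if_False)
qed

end
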